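(* Let $A:\mathbb{R}^n\to\mathbb{R}^m$ be linear, $\mathcal{C}\subseteq\mathbb{R}^n$ a nonempty closed convex set, $f:\mathbb{R}^n\to\mathbb{R}$ continuously differentiable, and $g:\mathbb{R}^m\to\mathbb{R}\cup\{\infty\}$ polyhedral convex, with $\mathrm{dom}\,g\cap A(\mathrm{ri}(\mathcal{C}))\neq\emptyset$. Let $(\bar x,\bar\lambda)\in\mathbb{R}^n\times\mathbb{R}^m$ satisfy: (i) $0\in\partial\delta_{\mathcal{C}}(\bar x)+\nabla f(\bar x)+A^\top\bar\lambda$ and $\bar\lambda\in\partial g(A\bar x)$; (ii) there exists a convex neighborhood $U_{\bar x}$ of $\bar x$ on which $\nabla^2 f$ exists and is continuous, and $\nabla^2 f(\bar x)$ is positive definite relative to the subspace $V_{\mathcal{C}}\cap\mathcal{S}_A(\bar x\mid\bar\lambda)$. Then there exists $\beta_0>0$ such that, for every $\beta>2\beta_0$, there exist closed convex neighborhoods $\mathcal{X}_\beta$ and $\Lambda_\beta$ of $\bar x$ and $\bar\lambda$, respectively, and a constant $\rho_\beta>0$ such that $\mathbb{B}(\bar\lambda,\rho_\beta)\subseteq\mathrm{int}\,\Lambda_\beta$, with the following property. Let $\{(x^k,y^k,\lambda^k):k\in\mathbb{N}\}$ be a well-defined sequence generated by the ADMM scheme with penalty parameter $\beta$. Suppose that $$\lambda^0\in\partial g(y^0),\qquad \beta^2\|y^0-A\bar x\|^2+\|\lambda^0-\bar\lambda\|^2\le\rho_\beta^2,$$ and that $x^k\in\mathcal{X}_\beta$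 for all $k\ge1$. Then $$x^k\to\bar x,\qquad y^k\to A\bar x,\qquad \lambda^k\to\widehat\lambda$$ for some $\widehat\lambda\in\Lambda^*_\beta$, where $$\Lambda^*_\beta:=\{\lambda\in\Lambda_\beta\mid 0\in\nabla f(\bar x)+A^\top\lambda+N_{\mathcal{C}}(\bar x),\ \lambda\in\partial g(A\bar x)\}.$$ Moreover, $\widehat\lambda\in\mathbb{B}(\bar\lambda,\rho_\beta)\subseteq\mathrm{int}\,\Lambda_\beta$.
   Context: The ADMM scheme with penalty parameter $\beta>0$ for $\min_{x\in\mathcal{C}}f(x)+g(Ax)$ is, for $k=0,1,2,\dots$, $$\begin{aligned} x^{k+1}&\in\arg\min_{x\in\mathcal{C}} f(x)+\langle\lambda^k,Ax\rangle+\tfrac{\beta}{2}\|Ax-y^k\|^2,\\ y^{k+1}&=\arg\min_y g(y)+\langle\lambda^k,-y\rangle+\tfrac{\beta}{2}\|Ax^{k+1}-y\|^2,\\ \lambda^{k+1}&=\lambda^k+\beta(Ax^{k+1}-y^{k+1}). \end{aligned}$$ "Well-defined" means that the minimizers in the $x$-step exist at every iteration. $\delta_{\mathcal{C}}$ is the indicator function of $\mathcal{C}$; $\partial$ is the convex subdifferential; $N_{\mathcal{C}}(x)=\partial\delta_{\mathcal{C}}(x)$ is the normal cone; $\mathbb{B}(x,r)$ is the closed Euclidean ball. A polyhedral convex function is a convex function whose epigraph is a polyhedral convex set. $V_{\mathcal{C}}=\mathrm{aff}_{\mathcal{C}}-x$ (any $x\in\mathcal{C}$) is the linear subspace parallel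 to the affine hull of $\mathcal{C}$. For $\lambda\in\partial g(y)$, $T_g(y\mid\lambda):=\{w\mid g'(y;w)=\langle\lambda,w\rangle\}$ with $g'(y;w)$ the one-sided directional derivative; $\mathcal{S}(y\mid\lambda):=T_g(y\mid\lambda)-T_g(y\mid\lambda)$ (the set of differences, the smallest subspace containing the cone $T_g(y\mid\lambda)$); $\mathcal{S}_A(\bar x\mid\bar\lambda):=\{v\in\mathbb{R}^n\mid Av\in\mathcal{S}(A\bar x\mid\bar\lambda)\}$. A symmetric matrix $H$ is positive definite relative to a subspace $V$ if $v^\top Hv>0$ for all $0\neq v\in V$. *)

theory Defs
  imports "HOL-Analysis.Analysis" "HOL-Library.Set_Algebras"
begin

definition gradient :: "('a::real_inner \<Rightarrow> real) \<Rightarrow> 'a \<Rightarrow> 'a" where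
  "gradient f x = (THE D. GDERIV f x :> D)"

lemma GDERIV_imp_gradient_eq:
  assumes "GDERIV f x :> D"
  shows "gradient f x = D"
proof -
  have "E = D" if "GDERIV f x :> E" for E
  proof -
    have "(\<lambda>h. h \<bullet> E) = (\<lambda>h. h \<bullet> D)"
      using that assms unfolding gderiv_def by (rule has_derivative_unique)
    then have "(E - D) \<bullet> E = (E - D) \<bullet> D"
      by meson
    then have "(E - D) \<bullet> (E - D) = 0"
      by (simp add: inner_diff_right)
    then show ?thesis
      by simp
  qed
  then show ?thesis
    unfolding gradient_def using assms by blast
qed

lemma gradient_works:
  fixes f :: "'a::euclidean_space \<Rightarrow> real"
  assumes "f differentiable (at x)"
  shows "GDERIV f x :> gradient f x"
proof -
  obtain f' where f': "(f has_derivative f') (at x)"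
    using assms unfolding differentiable_def by blast
  interpret linear f'
    using f' by (rule has_derivative_linear)
  have "f' h = h \<bullet> adjoint f' 1" for h
    using adjoint_works[OF linear_axioms, of h 1] by simp
  then have "f' = (\<lambda>h. h \<bullet> adjoint f' 1)"
    by blast
  with f' have "GDERIV f x :> adjoint f' 1"
    unfolding gderiv_def by simp
  then show ?thesis
    using GDERIV_imp_gradient_eq by metis
qed

definition continuously_differentiable :: "('a::real_inner \<Rightarrow> real) \<Rightarrow> bool" where
  "continuously_differentiable f \<longleftrightarrow>
     (\<forall>x. f differentiable (at x)) \<and> continuous_on UNIV (gradient f)"

definition hessian :: "(real ^ 'n \<Rightarrow> real) \<Rightarrow> real ^ 'n \<Rightarrow> real ^ 'n ^ 'n" where
  "hessian f x = matrix (frechet_derivative (gradient f) (at x))"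

lemma hessian_works:
  fixes f :: "real ^ 'n \<Rightarrow> real"
  assumes "gradient f differentiable (at x)"
  shows "(gradient f has_derivative (\<lambda>v. hessian f x *v v)) (at x)"
proof -
  have d: "(gradient f has_derivative frechet_derivative (gradient f) (at x)) (at x)"
    using assms frechet_derivative_works by blast
  have "(\<lambda>v. hessian f x *v v) = frechet_derivative (gradient f) (at x)"
    unfolding hessian_def using matrix_vector_mul(2)[OF has_derivative_linear[OF d]] by simp
  with d show ?thesis
    by simp
qed

definition hessian_continuous_on :: "(real ^ 'n) set \<Rightarrow> (real ^ 'n \<Rightarrow> real) \<Rightarrow> bool" where
  "hessian_continuous_on U f \<longleftrightarrow>
     (\<forall>x\<in>U. gradient f differentiable (at x)) \<and> continuous_on U (hessian f)"

(* Symmetry of the matrix is not part of the definition; a Hessian that is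
   continuous near x is symmetric at x. *)
definition pos_def_relative :: "real ^ 'n ^ 'n \<Rightarrow> (real ^ 'n) set \<Rightarrow> bool" where
  "pos_def_relative H V \<longleftrightarrow> (\<forall>v\<in>V. v \<noteq> 0 \<longrightarrow> v \<bullet> (H *v v) > 0)"

definition edom :: "('a \<Rightarrow> ereal) \<Rightarrow> 'a set" where
  "edom g = {y. g y < \<infinity>}"

(* The values are in R or +infinity.  A polyhedron is convex, so convexity of g is
   included in the condition on the epigraph. *)
definition polyhedral_convex :: "('a::euclidean_space \<Rightarrow> ereal) \<Rightarrow> bool" where
  "polyhedral_convex g \<longleftrightarrow>
     (\<forall>y. g y \<noteq> -\<infinity>) \<and> polyhedron {(y, t::real). g y \<le> ereal t}"

definition subdifferential :: "('a::real_inner \<Rightarrow> ereal) \<Rightarrow> 'a \<Rightarrow> 'a set" where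
  "subdifferential h x =
     {s. \<bar>h x\<bar> \<noteq> \<infinity> \<and> (\<forall>z. h x + ereal (s \<bullet> (z - x)) \<le> h z)}"

definition indicator_fun :: "'a set \<Rightarrow> 'a \<Rightarrow> ereal" where
  "indicator_fun C x = (if x \<in> C then 0 else \<infinity>)"

definition normal_cone :: "'a::real_inner set \<Rightarrow> 'a \<Rightarrow> 'a set" where
  "normal_cone C x = subdifferential (indicator_fun C) x"

(* At a point where g is finite, the limit exists in the extended reals for convex g. *)
definition dir_deriv :: "('a::real_normed_vector \<Rightarrow> ereal) \<Rightarrow> 'a \<Rightarrow> 'a \<Rightarrow> ereal" where
  "dir_deriv g y w = Lim (at_right 0) (\<lambda>t::real. (g (y + t *\<^sub>R w) - g y) / ereal t)"

definition T_cone :: "('a::real_inner \<Rightarrow> ereal) \<Rightarrow> 'a \<Rightarrow> 'a \<Rightarrow> 'a set" where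
  "T_cone g y lam = {w. dir_deriv g y w = ereal (lam \<bullet> w)}"

(* Pointwise differences u - v, not the set difference that minus denotes on sets. *)
definition S_space :: "('a::real_inner \<Rightarrow> ereal) \<Rightarrow> 'a \<Rightarrow> 'a \<Rightarrow> 'a set" where
  "S_space g y lam = {u - v | u v. u \<in> T_cone g y lam \<and> v \<in> T_cone g y lam}"

definition SA_space ::
  "('a \<Rightarrow> 'b::real_inner) \<Rightarrow> ('b \<Rightarrow> ereal) \<Rightarrow> 'a \<Rightarrow> 'b \<Rightarrow> 'a set" where
  "SA_space A g x lam = {v. A v \<in> S_space g (A x) lam}"

(* The base point x may be any element of C, so all choices are collected;
   they give the same set by parallel_subspace_eq. *)
definition parallel_subspace :: "'a::real_vector set \<Rightarrow> 'a set" where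
  "parallel_subspace C = {u - x | u x. u \<in> affine hull C \<and> x \<in> C}"

lemma parallel_subspace_eq:
  assumes "x \<in> C"
  shows "parallel_subspace C = (\<lambda>u. u - x) ` (affine hull C)"
proof -
  have "u - z \<in> (\<lambda>u. u - x) ` (affine hull C)" if "u \<in> affine hull C" "z \<in> C" for u z
  proof -
    have "u + 1 *\<^sub>R (x - z) \<in> affine hull C"
      by (rule mem_affine_3_minus[OF affine_affine_hull that(1)]) (auto intro: hull_inc that assms)
    then have "u + (x - z) \<in> affine hull C"
      by simp
    moreover have "u - z = (u + (x - z)) - x"
      by simp
    ultimately show ?thesis
      by blast
  qed
  then show ?thesis
    unfolding parallel_subspace_def using assms by blast
qed

(* Membership in arg min in the x-step includes the existence of a minimizer at every
   iteration.  In the y-step the objective is strongly convex, so the minimizer is unique.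
   The point x 0 is not used. *)
definition ADMM ::
  "(real ^ 'n \<Rightarrow> real ^ 'm) \<Rightarrow> (real ^ 'n) set \<Rightarrow> (real ^ 'n \<Rightarrow> real) \<Rightarrow> (real ^ 'm \<Rightarrow> ereal) \<Rightarrow> real \<Rightarrow>
    (nat \<Rightarrow> real ^ 'n) \<Rightarrow> (nat \<Rightarrow> real ^ 'm) \<Rightarrow> (nat \<Rightarrow> real ^ 'm) \<Rightarrow> bool" where
  "ADMM A C f g \<beta> x y lam \<longleftrightarrow>
     (\<forall>k.
       is_arg_min (\<lambda>u. f u + lam k \<bullet> A u + \<beta> / 2 * (norm (A u - y k))\<^sup>2) (\<lambda>u. u \<in> C) (x (Suc k)) \<and>
       is_arg_min (\<lambda>v. g v + ereal (lam k \<bullet> (- v) + \<beta> / 2 * (norm (A (x (Suc k)) - v))\<^sup>2))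
         (\<lambda>v. True) (y (Suc k)) \<and>
       lam (Suc k) = lam k + \<beta> *\<^sub>R (A (x (Suc k)) - y (Suc k)))"

definition multiplier_set ::
  "(real ^ 'n \<Rightarrow> real ^ 'm) \<Rightarrow> (real ^ 'n) set \<Rightarrow> (real ^ 'n \<Rightarrow> real) \<Rightarrow> (real ^ 'm \<Rightarrow> ereal) \<Rightarrow>
    real ^ 'n \<Rightarrow> (real ^ 'm) set \<Rightarrow> (real ^ 'm) set" where
  "multiplier_set A C f g xbar L =
     {lam \<in> L. 0 \<in> (gradient f xbar + adjoint A lam) +o normal_cone C xbar \<and>
       lam \<in> subdifferential g (A xbar)}"

end

theory Submission
  imports Defs
begin

text \<open>The KKT pair \<open>(xbar, lambar)\<close> attracts ADMM locally although \<^term>\<open>f\<close> need not be convex, because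
  the possible loss from the nonconvexity of \<^term>\<open>f\<close> is paid for by the squared multiplier steps
  that ADMM gains at every iteration.

  The merit function is \<open>\<Phi> k = \<beta>\<^sup>2 * (norm (y k - A xbar))\<^sup>2 + (norm (lam k - lambar))\<^sup>2\<close>.  The optimality
  conditions of the two minimizations and monotonicity of the subdifferential of \<^term>\<open>g\<close> give
  (\<open>ADMM_descent\<close>)
  \<open>\<Phi> (k+1) + (norm (lam (k+1) - lam k))\<^sup>2 + 2 * \<beta> * G \<le> \<Phi> k\<close>, where
  \<open>G = (gradient f (x (k+1)) - gradient f xbar) \<bullet> (x (k+1) - xbar)\<close>.  For convex \<^term>\<open>f\<close> this is
  the classical estimate with \<open>G \<ge> 0\<close>.  Here \<open>h = x (k+1) - xbar\<close> lies in the parallel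
  subspace of \<^term>\<open>C\<close>, and \<open>G\<close> is nearly \<open>h \<bullet> (H *v h)\<close> with \<open>H\<close> the Hessian at \<^term>\<open>xbar\<close>, which is
  known to be positive only if \<^term>\<open>A\<close> maps \<^term>\<open>h\<close> into the space \<open>\<S>\<close>.  A penalty repairs
  this (\<open>pos_def_relative_penalty\<close>): for suitable \<open>b, c > 0\<close> and all \<^term>\<open>w\<close> in the subspace of \<open>\<S>\<close>
  spanned by the differences \<open>v - A xbar\<close> with \<open>lambar \<in> subdifferential g v\<close>,
  \<open>h \<bullet> (H *v h) + b * (norm (A h - w))\<^sup>2 \<ge> c * (norm h)\<^sup>2\<close>.

  The right choice is \<open>w = y (k+1) - A xbar\<close>, since then \<open>A h - w = (lam (k+1) - lam k) / \<beta>\<close> by the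
  multiplier update, and the penalty costs \<open>2 * b / \<beta>\<close> times the squared multiplier step.
  That is less than the available gain exactly if \<open>\<beta> > 2 * b\<close>, so \<^term>\<open>b\<close> serves as \<open>\<beta>\<^sub>0\<close>.

  That \<^term>\<open>w\<close> lies in this subspace is where \<^term>\<open>g\<close> being polyhedral enters.  If \<open>lam (k+1)\<close> is close to
  \<^term>\<open>lambar\<close>, then \<^term>\<open>lambar\<close> itself is a subgradient at \<open>y (k+1)\<close> (\<open>subgradient_perturbation\<close>), so
  \<^term>\<open>g\<close> is affine with slope \<^term>\<open>lambar\<close> between \<open>A xbar\<close> and \<open>y (k+1)\<close>, and the displacement is a
  direction in \<open>T_cone\<close>.  The closeness of \<open>lam (k+1)\<close> follows from \<open>\<Phi> k \<le> \<rho>\<^sup>2\<close> and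
  from \<open>x (k+1)\<close> being close to \<^term>\<open>xbar\<close> (\<open>ADMM_multiplier_bound\<close>), so the argument can be
  iterated.  The gains then tend to zero, which yields \<open>x k \<longlonglongrightarrow> xbar\<close> and \<open>y k \<longlonglongrightarrow> A xbar\<close>; convergence of the
  multipliers comes from recentring \<open>\<Phi>\<close> at one of their limit points (\<open>ADMM_convergence\<close>).\<close>

section \<open>Subgradients of convex functions\<close>

lemma subdifferentialE:
  assumes "s \<in> subdifferential h x"
  obtains r where "h x = ereal r" "\<And>z. ereal (r + s \<bullet> (z - x)) \<le> h z"
proof -
  have "\<bar>h x\<bar> \<noteq> \<infinity>" and le: "\<And>z. h x + ereal (s \<bullet> (z - x)) \<le> h z"
    using assms by (auto simp: subdifferential_def)
  then obtain r where r: "h x = ereal r"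
    by (cases "h x") auto
  show thesis
    using that[OF r] le r by simp
qed

lemma subdifferentialI:
  assumes "h x = ereal r" "\<And>z. ereal (r + s \<bullet> (z - x)) \<le> h z"
  shows "s \<in> subdifferential h x"
  using assms by (simp add: subdifferential_def)

lemma subdifferential_monotone:
  assumes "s \<in> subdifferential h x" "t \<in> subdifferential h y"
  shows "0 \<le> (s - t) \<bullet> (x - y)"
proof -
  obtain a where a: "h x = ereal a" "\<And>z. ereal (a + s \<bullet> (z - x)) \<le> h z"
    using assms(1) by (rule subdifferentialE) blast
  obtain b where b: "h y = ereal b" "\<And>z. ereal (b + t \<bullet> (z - y)) \<le> h z"
    using assms(2) by (rule subdifferentialE) blast
  have "a + s \<bullet> (y - x) \<le> b" "b + t \<bullet> (x - y) \<le> a"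
    using a(2)[of y] b(2)[of x] a(1) b(1) by simp_all
  then show ?thesis
    by (simp add: inner_diff_left inner_diff_right)
qed

lemma closed_subdifferential: "closed (subdifferential h x)"
proof (cases "\<bar>h x\<bar> = \<infinity>")
  case True
  then show ?thesis
    by (simp add: subdifferential_def)
next
  case False
  then obtain r where r: "h x = ereal r"
    by (cases "h x") auto
  have "closed {s. ereal (r + s \<bullet> (z - x)) \<le> h z}" for z
  proof (cases "h z")
    case (real b)
    have "closed {s. r + s \<bullet> (z - x) \<le> b}"
      by (intro closed_Collect_le continuous_intros)
    with real show ?thesis
      by simp
  qed simp_all
  then have "closed (\<Inter>z. {s. ereal (r + s \<bullet> (z - x)) \<le> h z})"
    by blast
  moreover have "subdifferential h x = (\<Inter>z. {s. ereal (r + s \<bullet> (z - x)) \<le> h z})"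
    by (auto simp: subdifferential_def r)
  ultimately show ?thesis
    by simp
qed

text \<open>Two points with a common subgradient \<^term>\<open>s\<close> lie on the same affine minorant of
  slope \<^term>\<open>s\<close>, which is why the values at such points depend continuously on the point even
  where \<^term>\<open>h\<close> itself is not continuous.\<close>

lemma common_subgradient_value:
  assumes "s \<in> subdifferential h x" "s \<in> subdifferential h y" "h x = ereal r"
  shows "h y = ereal (r + s \<bullet> (y - x))"
proof -
  obtain a where a: "h x = ereal a" "\<And>z. ereal (a + s \<bullet> (z - x)) \<le> h z"
    using assms(1) by (rule subdifferentialE) blast
  obtain b where b: "h y = ereal b" "\<And>z. ereal (b + s \<bullet> (z - y)) \<le> h z"
    using assms(2) by (rule subdifferentialE) blast
  have "r + s \<bullet> (y - x) \<le> b" "b + s \<bullet> (x - y) \<le> r"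
    using a(2)[of y] b(2)[of x] a(1) b(1) assms(3) by simp_all
  then show ?thesis
    using b(1) by (simp add: inner_diff_right)
qed

lemma subdifferential_indicator_iff:
  "s \<in> subdifferential (indicator_fun C) x \<longleftrightarrow> x \<in> C \<and> (\<forall>z\<in>C. s \<bullet> (z - x) \<le> 0)"
  by (auto simp: subdifferential_def indicator_fun_def)

lemma stationary_iff:
  fixes A :: "'a::euclidean_space \<Rightarrow> 'b::euclidean_space"
  assumes "linear A"
  shows "0 \<in> (d + adjoint A s) +o subdifferential (indicator_fun C) x \<longleftrightarrow>
    x \<in> C \<and> (\<forall>z\<in>C. 0 \<le> d \<bullet> (z - x) + s \<bullet> A (z - x))"
proof -
  have "0 \<in> (d + adjoint A s) +o subdifferential (indicator_fun C) x \<longleftrightarrow>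
      - (d + adjoint A s) \<in> subdifferential (indicator_fun C) x"
  proof -
    have "0 = (d + adjoint A s) + b \<longleftrightarrow> b = - (d + adjoint A s)" for b
      by (metis add_eq_0_iff)
    then show ?thesis
      unfolding elt_set_plus_def by simp
  qed
  also have "\<dots> \<longleftrightarrow> x \<in> C \<and> (\<forall>z\<in>C. 0 \<le> d \<bullet> (z - x) + s \<bullet> A (z - x))"
  proof -
    have "- (d + adjoint A s) \<bullet> v = - (d \<bullet> v + s \<bullet> A v)" for v
      by (simp add: inner_add_left inner_diff_left adjoint_works[OF assms]
          inner_commute[of "adjoint A s"] inner_commute[of s])
    then show ?thesis
      by (simp only: subdifferential_indicator_iff neg_le_0_iff_le)
  qed
  finally show ?thesis .
qed

section \<open>Polyhedral convex functions\<close>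

lemma polyhedral_convex_combination:
  assumes "polyhedral_convex g" "g a \<le> ereal s" "g b \<le> ereal t" "0 \<le> u" "u \<le> 1"
  shows "g ((1 - u) *\<^sub>R a + u *\<^sub>R b) \<le> ereal ((1 - u) * s + u * t)"
proof -
  have "convex {(y, t::real). g y \<le> ereal t}"
    using assms(1) by (simp add: polyhedral_convex_def polyhedron_imp_convex)
  from convexD_alt[OF this, of "(a, s)" "(b, t)" u] assms(2-) show ?thesis
    by simp
qed

text \<open>The points with subgradient \<^term>\<open>s\<close> are the minimizers of the convex function
  \<open>g y - s \<bullet> y\<close>.\<close>

lemma convex_common_subgradient:
  assumes "polyhedral_convex g"
  shows "convex {y. s \<in> subdifferential g y}"
  unfolding convex_alt
proof (intro ballI allI impI)
  fix a b and u :: real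
  assume a: "a \<in> {y. s \<in> subdifferential g y}" and b: "b \<in> {y. s \<in> subdifferential g y}"
    and u: "0 \<le> u \<and> u \<le> 1"
  define c where "c = (1 - u) *\<^sub>R a + u *\<^sub>R b"
  obtain r where r: "g a = ereal r" "\<And>z. ereal (r + s \<bullet> (z - a)) \<le> g z"
    using a by (auto elim: subdifferentialE)
  have gb: "g b = ereal (r + s \<bullet> (b - a))"
    using common_subgradient_value a b r(1) by auto
  have val: "(1 - u) * r + u * (r + s \<bullet> (b - a)) = r + s \<bullet> (c - a)"
    by (simp add: c_def inner_diff_right inner_add_right algebra_simps)
  have "g c \<le> ereal (r + s \<bullet> (c - a))"
    using polyhedral_convex_combination[OF assms, of a r b "r + s \<bullet> (b - a)" u] u r(1) gb
    by (simp add: c_def[symmetric] val)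
  then have gc: "g c = ereal (r + s \<bullet> (c - a))"
    using r(2)[of c] by simp
  have "s \<in> subdifferential g c"
  proof (rule subdifferentialI[where h = g and x = c, OF gc])
    fix z
    show "ereal (r + s \<bullet> (c - a) + s \<bullet> (z - c)) \<le> g z"
      using r(2)[of z] by (simp add: inner_diff_right)
  qed
  then show "(1 - u) *\<^sub>R a + u *\<^sub>R b \<in> {y. s \<in> subdifferential g y}"
    by (simp add: c_def)
qed

text \<open>A slope \<^term>\<open>s\<close> is a subgradient at \<^term>\<open>y\<close> exactly if \<open>(y, g y)\<close> lies in the face of the
  epigraph on which the functional \<open>(s, -1)\<close> is maximal.  Hence the subdifferential at
  \<^term>\<open>y\<close> is determined by the set of faces that contain \<open>(y, g y)\<close>, and a polyhedron has only
  finitely many faces.\<close>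

lemma finite_subdifferentials:
  fixes g :: "'a::euclidean_space \<Rightarrow> ereal"
  assumes "polyhedral_convex g"
  shows "finite (range (subdifferential g))"
proof -
  define E where "E = {(y, t::real). g y \<le> ereal t}"
  define F where "F s = {p\<in>E. \<forall>q\<in>E. (s, -1::real) \<bullet> q \<le> (s, -1) \<bullet> p}" for s :: 'a
  define faces where "faces y = {T. T face_of E \<and> (y, real_of_ereal (g y)) \<in> T}" for y
  have "polyhedron E"
    using assms by (simp add: polyhedral_convex_def E_def)
  then have fin: "finite {T. T face_of E}" and "convex E"
    by (simp_all add: finite_polyhedron_faces polyhedron_imp_convex)
  have face: "F s face_of E" for s
  proof (cases "F s = {}")
    case False
    then obtain p where p: "p \<in> F s"
      by blast
    have "F s = E \<inter> {q. (s, -1) \<bullet> q = (s, -1) \<bullet> p}"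
    proof (intro equalityI subsetI)
      fix q
      assume q: "q \<in> F s"
      then have "(s, -1) \<bullet> p \<le> (s, -1) \<bullet> q" "(s, -1) \<bullet> q \<le> (s, -1) \<bullet> p"
        using p unfolding F_def by blast+
      then show "q \<in> E \<inter> {q. (s, -1) \<bullet> q = (s, -1) \<bullet> p}"
        using q by (simp add: F_def)
    next
      fix q
      assume "q \<in> E \<inter> {q. (s, -1) \<bullet> q = (s, -1) \<bullet> p}"
      then show "q \<in> F s"
        using p by (simp add: F_def)
    qed
    moreover have "E \<inter> {q. (s, -1) \<bullet> q = (s, -1) \<bullet> p} face_of E"
      using p by (intro face_of_Int_supporting_hyperplane_le[OF \<open>convex E\<close>]) (simp add: F_def)
    ultimately show ?thesis
      by simp
  qed simp
  have sub: "s \<in> subdifferential g y \<longleftrightarrow> F s \<in> faces y" if "g y = ereal r" for s y r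
  proof -
    have "s \<in> subdifferential g y \<longleftrightarrow> (\<forall>z t. g z \<le> ereal t \<longrightarrow> r + s \<bullet> (z - y) \<le> t)"
    proof
      assume "s \<in> subdifferential g y"
      then have *: "ereal (r + s \<bullet> (z - y)) \<le> g z" for z
        using that by (auto simp: subdifferential_def)
      show "\<forall>z t. g z \<le> ereal t \<longrightarrow> r + s \<bullet> (z - y) \<le> t"
        using * order_trans[of "ereal _"] by (metis ereal_less_eq(3))
    next
      assume *: "\<forall>z t. g z \<le> ereal t \<longrightarrow> r + s \<bullet> (z - y) \<le> t"
      show "s \<in> subdifferential g y"
      proof (rule subdifferentialI[where h = g and x = y, OF that])
        fix z
        show "ereal (r + s \<bullet> (z - y)) \<le> g z"
          using * assms by (cases "g z") (auto simp: polyhedral_convex_def)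
      qed
    qed
    also have "\<dots> \<longleftrightarrow> (\<forall>z t. g z \<le> ereal t \<longrightarrow> s \<bullet> z - t \<le> s \<bullet> y - r)"
    proof -
      have "r + s \<bullet> (z - y) \<le> t \<longleftrightarrow> s \<bullet> z - t \<le> s \<bullet> y - r" for z t
        by (simp add: inner_diff_right) linarith
      then show ?thesis
        by simp
    qed
    also have "\<dots> \<longleftrightarrow> (y, r) \<in> F s"
      using that by (auto simp: F_def E_def)
    also have "\<dots> \<longleftrightarrow> F s \<in> faces y"
      using face that by (simp add: faces_def)
    finally show ?thesis .
  qed
  have "subdifferential g y \<in> insert {} ((\<lambda>\<T>. {s. F s \<in> \<T>}) ` Pow {T. T face_of E})" for y
  proof (cases "\<bar>g y\<bar> = \<infinity>")
    case True
    then show ?thesis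
      by (simp add: subdifferential_def)
  next
    case False
    then obtain r where "g y = ereal r"
      by (cases "g y") auto
    then have "subdifferential g y = {s. F s \<in> faces y}"
      using sub by blast
    moreover have "faces y \<in> Pow {T. T face_of E}"
      by (auto simp: faces_def)
    ultimately show ?thesis
      by blast
  qed
  then have "range (subdifferential g) \<subseteq>
      insert {} ((\<lambda>\<T>. {s. F s \<in> \<T>}) ` Pow {T. T face_of E})"
    by blast
  then show ?thesis
    by (rule finite_subset) (use fin in simp)
qed

text \<open>The finitely many subdifferentials that miss \<^term>\<open>s\<close> form a closed set, so they all stay
  away from \<^term>\<open>s\<close>.  The radius is uniform in the point \<^term>\<open>y\<close>: closeness of
  the multipliers alone decides.\<close>

lemma subgradient_perturbation:
  fixes g :: "'a::euclidean_space \<Rightarrow> ereal"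
  assumes "polyhedral_convex g"
  obtains \<delta> where "\<delta> > 0"
    "\<And>t y. norm (t - s) \<le> \<delta> \<Longrightarrow> t \<in> subdifferential g y \<Longrightarrow> s \<in> subdifferential g y"
proof -
  define B where "B = \<Union>{D \<in> range (subdifferential g). s \<notin> D}"
  have "closed B"
    unfolding B_def using finite_subdifferentials[OF assms]
    by (intro closed_Union) (auto simp: closed_subdifferential)
  moreover have "s \<notin> B"
    by (auto simp: B_def)
  ultimately obtain \<delta> where \<delta>: "\<delta> > 0" "cball s \<delta> \<subseteq> - B"
    using open_contains_cball[of "- B"] by auto
  show thesis
  proof (rule that[OF \<delta>(1)])
    fix t y
    assume "norm (t - s) \<le> \<delta>" and t: "t \<in> subdifferential g y"
    then have "t \<notin> B"
      using \<delta>(2) by (auto simp: dist_norm norm_minus_commute)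
    then show "s \<in> subdifferential g y"
      using t by (auto simp: B_def)
  qed
qed

text \<open>On the segment from \<^term>\<open>a\<close> to \<^term>\<open>b\<close> the function is affine with slope \<^term>\<open>s\<close>, so
  the difference quotients that define the directional derivative are eventually constant.\<close>

lemma common_subgradient_T_cone:
  fixes g :: "'a::euclidean_space \<Rightarrow> ereal"
  assumes "polyhedral_convex g" "s \<in> subdifferential g a" "s \<in> subdifferential g b" "t > 0"
  shows "t *\<^sub>R (b - a) \<in> T_cone g a s"
proof -
  obtain r where r: "g a = ereal r"
    using assms(2) by (rule subdifferentialE) blast
  have "(g (a + \<tau> *\<^sub>R t *\<^sub>R (b - a)) - g a) / ereal \<tau> = ereal (s \<bullet> (t *\<^sub>R (b - a)))"
    if "0 < \<tau>" "\<tau> < 1 / t" for \<tau>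
  proof -
    have *: "0 \<le> \<tau> * t" "\<tau> * t \<le> 1"
      using that assms(4) by (auto simp: field_simps)
    have "s \<in> subdifferential g ((1 - \<tau> * t) *\<^sub>R a + (\<tau> * t) *\<^sub>R b)"
      using convexD_alt[OF convex_common_subgradient[OF assms(1)], of a s b "\<tau> * t"] * assms(2,3)
      by simp
    moreover have "(1 - \<tau> * t) *\<^sub>R a + (\<tau> * t) *\<^sub>R b = a + \<tau> *\<^sub>R t *\<^sub>R (b - a)"
      by (simp add: algebra_simps)
    ultimately have "g (a + \<tau> *\<^sub>R t *\<^sub>R (b - a)) = ereal (r + s \<bullet> (\<tau> *\<^sub>R t *\<^sub>R (b - a)))"
      using common_subgradient_value[OF assms(2) _ r] by auto
    then show ?thesis
      using that r by simp
  qed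
  then have "eventually (\<lambda>\<tau>. (g (a + \<tau> *\<^sub>R t *\<^sub>R (b - a)) - g a) / ereal \<tau> =
      ereal (s \<bullet> (t *\<^sub>R (b - a)))) (at_right 0)"
    unfolding eventually_at_right_field using assms(4) by (intro exI[of _ "1 / t"]) simp
  then have "((\<lambda>\<tau>. (g (a + \<tau> *\<^sub>R t *\<^sub>R (b - a)) - g a) / ereal \<tau>) \<longlongrightarrow>
      ereal (s \<bullet> (t *\<^sub>R (b - a)))) (at_right 0)"
    by (rule tendsto_eventually)
  then have "dir_deriv g a (t *\<^sub>R (b - a)) = ereal (s \<bullet> (t *\<^sub>R (b - a)))"
    unfolding dir_deriv_def by (intro tendsto_Lim) simp_all
  then show ?thesis
    by (simp add: T_cone_def)
qed

lemma span_convex_subset_differences: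
  fixes M :: "'a::real_vector set"
  assumes "convex M" "0 \<in> M"
  shows "span M \<subseteq> {t *\<^sub>R (u - v) | t u v. t > 0 \<and> u \<in> M \<and> v \<in> M}" (is "_ \<subseteq> ?D")
proof (rule span_minimal)
  show "M \<subseteq> ?D"
  proof
    fix u
    assume "u \<in> M"
    moreover have "u = 1 *\<^sub>R (u - 0)"
      by simp
    ultimately show "u \<in> ?D"
      using assms(2) zero_less_one by blast
  qed
  show "subspace ?D"
    unfolding subspace_def
  proof (intro conjI ballI allI)
    have "0 = 1 *\<^sub>R ((0::'a) - 0)"
      by simp
    then show "0 \<in> ?D"
      using assms(2) zero_less_one by blast
  next
    fix a b
    assume "a \<in> ?D" "b \<in> ?D"
    then obtain s u v t p q where a: "a = s *\<^sub>R (u - v)" "s > 0" "u \<in> M" "v \<in> M"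
      and b: "b = t *\<^sub>R (p - q)" "t > 0" "p \<in> M" "q \<in> M"
      by blast
    define \<mu> \<nu> where "\<mu> = s / (s + t)" and "\<nu> = t / (s + t)"
    have \<mu>: "0 \<le> \<mu>" "0 \<le> \<nu>" "\<mu> + \<nu> = 1" "(s + t) * \<mu> = s" "(s + t) * \<nu> = t"
      using a(2) b(2) by (auto simp: \<mu>_def \<nu>_def add_divide_distrib[symmetric])
    have "\<mu> *\<^sub>R u + \<nu> *\<^sub>R p \<in> M" "\<mu> *\<^sub>R v + \<nu> *\<^sub>R q \<in> M"
      using a b \<mu> assms(1) by (auto intro!: convexD)
    moreover have "a + b = (s + t) *\<^sub>R ((\<mu> *\<^sub>R u + \<nu> *\<^sub>R p) - (\<mu> *\<^sub>R v + \<nu> *\<^sub>R q))"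
      by (simp only: scaleR_diff_right scaleR_add_right scaleR_scaleR \<mu> a b) simp
    moreover have "s + t > 0"
      using a b by simp
    ultimately show "a + b \<in> ?D"
      by blast
  next
    fix c :: real and a
    assume "a \<in> ?D"
    then obtain s u v where a: "a = s *\<^sub>R (u - v)" "s > 0" "u \<in> M" "v \<in> M"
      by blast
    consider "c = 0" | "c > 0" | "c < 0"
      by linarith
    then show "c *\<^sub>R a \<in> ?D"
    proof cases
      case 1
      then have "c *\<^sub>R a = 1 *\<^sub>R (u - u)"
        by simp
      then show ?thesis
        using a(3) zero_less_one by blast
    next
      case 2
      then have "c *\<^sub>R a = (c * s) *\<^sub>R (u - v)" "c * s > 0"
        using a by simp_all
      then show ?thesis
        using a by blast
    next
      case 3
      then have "c *\<^sub>R a = (- c * s) *\<^sub>R (v - u)" "- c * s > 0"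
        using a(2) by (simp_all add: a(1) algebra_simps mult_neg_pos)
      then show ?thesis
        using a by blast
    qed
  qed
qed

text \<open>The displacements \<open>b - a\<close> are what the iterates produce, and their span is a closed
  subspace, as the penalty argument below requires.  It is contained in \<open>S_space\<close> because every
  element of the span of a convex set through the origin is a scaled difference of two of
  its points.\<close>

lemma span_common_subgradient_subset_S_space:
  fixes g :: "'a::euclidean_space \<Rightarrow> ereal"
  assumes "polyhedral_convex g" "s \<in> subdifferential g a"
  shows "span {b - a | b. s \<in> subdifferential g b} \<subseteq> S_space g a s"
proof -
  define M where "M = {b - a | b. s \<in> subdifferential g b}"
  have M: "M = (\<lambda>b. b - a) ` {b. s \<in> subdifferential g b}"
    by (auto simp: M_def)
  have "convex M"
    unfolding M using convex_translation_subtract[OF convex_common_subgradient[OF assms(1)]] by simp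
  moreover have "0 \<in> M"
    using assms(2) by (force simp: M_def)
  moreover have "t *\<^sub>R (u - v) \<in> S_space g a s" if "t > 0" "u \<in> M" "v \<in> M" for t u v
  proof -
    have "t *\<^sub>R u \<in> T_cone g a s" "t *\<^sub>R v \<in> T_cone g a s"
      using that common_subgradient_T_cone[OF assms] by (auto simp: M_def)
    then show ?thesis
      unfolding S_space_def using scaleR_diff_right[of t u v] by blast
  qed
  ultimately have "span M \<subseteq> S_space g a s"
    using span_convex_subset_differences[of M] by (auto simp: subset_iff)
  then show ?thesis
    by (simp add: M_def)
qed

section \<open>Positive definiteness relative to a subspace\<close>

lemma subspace_parallel_subspace:
  assumes "x \<in> C"
  shows "subspace (parallel_subspace C)"
  unfolding parallel_subspace_eq[OF assms]
  by (rule affine_diffs_subspace_subtract) (simp_all add: affine_affine_hull assms hull_inc)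

lemma diff_mem_parallel_subspace:
  assumes "u \<in> C" "x \<in> C"
  shows "u - x \<in> parallel_subspace C"
  using assms by (auto simp: parallel_subspace_def intro: hull_inc)

text \<open>A quadratic form that is positive on the part of \<^term>\<open>V\<close> mapped into \<^term>\<open>W\<close> becomes
  positive on all of \<^term>\<open>V\<close> after adding a large multiple of the squared distance from the
  image to \<^term>\<open>W\<close> (a form of the Debreu--Finsler lemma).  If no multiple worked, unit vectors
  that violate the bound would accumulate at a unit vector of \<^term>\<open>V\<close> mapped into
  \<^term>\<open>W\<close>.\<close>

lemma pos_def_relative_penalty:
  fixes H :: "real ^ 'n ^ 'n" and A :: "real ^ 'n \<Rightarrow> real ^ 'm"
  assumes "linear A" "subspace V" "subspace W"
    and pos: "pos_def_relative H (V \<inter> {v. A v \<in> W})"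
  obtains b c where "b > 0" "c > 0"
    "\<And>v w. v \<in> V \<Longrightarrow> w \<in> W \<Longrightarrow>
      c * (norm v)\<^sup>2 \<le> v \<bullet> (H *v v) + b * (norm (A v - w))\<^sup>2"
proof -
  define q where "q v = v \<bullet> (H *v v)" for v
  define p where "p v = (infdist (A v) W)\<^sup>2" for v
  have W: "closed W" "W \<noteq> {}"
    using assms(3) closed_subspace subspace_0 by auto
  have cont_A: "continuous_on UNIV A"
    using assms(1) by (simp add: linear_continuous_on linear_linear)
  have cont: "continuous_on UNIV q" "continuous_on UNIV p"
    unfolding q_def p_def
    by (intro continuous_intros cont_A matrix_vector_mul_linear linear_continuous_on
        matrix_vector_mul_bounded_linear)+
  have "\<exists>n. \<forall>v\<in>V \<inter> sphere 0 1. 1 / Suc n \<le> q v + Suc n * p v"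
  proof (rule ccontr)
    assume "\<nexists>n. \<forall>v\<in>V \<inter> sphere 0 1. 1 / Suc n \<le> q v + Suc n * p v"
    then have "\<forall>n. \<exists>v. v \<in> V \<inter> sphere 0 1 \<and> q v + Suc n * p v < 1 / Suc n"
      by (meson not_le)
    then obtain v where v: "\<And>n. v n \<in> V \<inter> sphere 0 1"
      and less: "\<And>n. q (v n) + Suc n * p (v n) < 1 / Suc n"
      by metis
    have "compact (V \<inter> sphere 0 1)"
      by (intro closed_Int_compact closed_subspace assms(2)) simp
    then obtain u r where u: "u \<in> V \<inter> sphere 0 1" and r: "strict_mono r" and lim: "(v \<circ> r) \<longlonglongrightarrow> u"
      using v unfolding compact_def by metis
    have tends: "(\<lambda>n. q (v (r n))) \<longlonglongrightarrow> q u" "(\<lambda>n. p (v (r n))) \<longlonglongrightarrow> p u"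
      using cont lim continuous_on_tendsto_compose[of UNIV _ "v \<circ> r" u sequentially]
      by (auto simp: o_def)
    have inv: "(\<lambda>n. 1 / real (Suc (r n))) \<longlonglongrightarrow> 0"
      using LIMSEQ_subseq_LIMSEQ[OF LIMSEQ_Suc[OF lim_1_over_n] r] by (simp add: o_def)
    have "q u \<le> 0"
    proof (rule LIMSEQ_le[OF tends(1) inv], intro exI allI impI)
      fix n
      have "0 \<le> Suc (r n) * p (v (r n))"
        by (simp add: p_def)
      then show "q (v (r n)) \<le> 1 / real (Suc (r n))"
        using less[of "r n"] by linarith
    qed
    (* Dividing the violated bound by n forces the penalty term to vanish in the limit. *)
    moreover have "p u \<le> 0"
    proof (rule LIMSEQ_le)
      show "(\<lambda>n. (1 / real (Suc (r n)) - q (v (r n))) * (1 / real (Suc (r n)))) \<longlonglongrightarrow> 0"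
        using tendsto_mult[OF tendsto_diff[OF inv tends(1)] inv] by simp
      show "\<exists>N. \<forall>n\<ge>N. p (v (r n)) \<le>
          (1 / real (Suc (r n)) - q (v (r n))) * (1 / real (Suc (r n)))"
      proof (intro exI allI impI)
        fix n
        have "p (v (r n)) * Suc (r n) \<le> 1 / real (Suc (r n)) - q (v (r n))"
          using less[of "r n"] by (simp add: mult.commute)
        then show "p (v (r n)) \<le> (1 / real (Suc (r n)) - q (v (r n))) * (1 / real (Suc (r n)))"
          by (simp add: pos_le_divide_eq)
      qed
    qed (rule tends)
    then have "infdist (A u) W = 0"
      by (simp add: p_def)
    then have "A u \<in> W"
      using in_closed_iff_infdist_zero[OF W] by simp
    moreover have "u \<in> V" "u \<noteq> 0"
      using u by auto
    ultimately show False
      using pos unfolding pos_def_relative_def q_def by (metis IntI mem_Collect_eq not_le)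
  qed
  then obtain n where "\<forall>v\<in>V \<inter> sphere 0 1. 1 / Suc n \<le> q v + Suc n * p v"
    by blast
  then have n: "1 / Suc n \<le> q v + Suc n * p v" if "v \<in> V" "norm v = 1" for v
    using that by simp
  show thesis
  proof (rule that[of "real (Suc n)" "1 / real (Suc n)"])
    fix v w
    assume v: "v \<in> V" and w: "w \<in> W"
    show "1 / real (Suc n) * (norm v)\<^sup>2 \<le> v \<bullet> (H *v v) + real (Suc n) * (norm (A v - w))\<^sup>2"
    proof (cases "v = 0")
      case False
      define a where "a = norm v"
      have a: "a > 0"
        using False by (simp add: a_def)
      define e f where "e = (1 / a) *\<^sub>R v" and "f = (1 / a) *\<^sub>R w"
      have e: "e \<in> V" "norm e = 1" "f \<in> W"
        using v w assms(2,3) a by (auto simp: e_def f_def a_def subspace_scale)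
      have vw: "v = a *\<^sub>R e" "w = a *\<^sub>R f"
        using a by (simp_all add: e_def f_def)
      have "p e \<le> (norm (A e - f))\<^sup>2"
        unfolding p_def using infdist_le[OF e(3), of "A e"]
        by (intro power_mono) (simp_all add: dist_norm infdist_nonneg)
      then have "real (Suc n) * p e \<le> real (Suc n) * (norm (A e - f))\<^sup>2"
        by (intro mult_left_mono) simp_all
      then have "1 / Suc n \<le> q e + Suc n * (norm (A e - f))\<^sup>2"
        using n[OF e(1,2)] by linarith
      then have "a\<^sup>2 * (1 / Suc n) \<le> a\<^sup>2 * (q e + Suc n * (norm (A e - f))\<^sup>2)"
        by (intro mult_left_mono) simp_all
      moreover have "q v = a\<^sup>2 * q e"
        by (simp add: q_def vw matrix_vector_mult_scaleR power2_eq_square)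
      moreover have "A v - w = a *\<^sub>R (A e - f)"
        by (simp add: vw linear_scale[OF assms(1)] scaleR_diff_right)
      then have "(norm (A v - w))\<^sup>2 = a\<^sup>2 * (norm (A e - f))\<^sup>2"
        by (simp add: power_mult_distrib)
      ultimately show ?thesis
        unfolding q_def[symmetric] a_def[symmetric] by (simp add: algebra_simps)
    qed (simp add: matrix_vector_mult_0_right)
  qed simp_all
qed

text \<open>The remainder in the linear approximation of the gradient at the base point is of smaller
  order than the displacement, so it costs an arbitrarily small multiple of the squared norm.\<close>

lemma gradient_quadratic_lower_bound:
  fixes f :: "real ^ 'n \<Rightarrow> real"
  assumes "gradient f differentiable (at a)" "c > 0"
  obtains r where "r > 0"
    "\<And>x. norm (x - a) \<le> r \<Longrightarrow> (x - a) \<bullet> (hessian f a *v (x - a)) - c * (norm (x - a))\<^sup>2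
      \<le> (gradient f x - gradient f a) \<bullet> (x - a)"
proof -
  obtain d where d: "d > 0" "\<And>x. norm (x - a) < d \<Longrightarrow>
      norm (gradient f x - gradient f a - hessian f a *v (x - a)) \<le> c * norm (x - a)"
    using hessian_works[OF assms(1)] assms(2) unfolding has_derivative_at_alt by metis
  show thesis
  proof (rule that[of "d / 2"])
    fix x
    assume x: "norm (x - a) \<le> d / 2"
    define h e where "h = x - a" and "e = gradient f x - gradient f a - hessian f a *v h"
    have "\<bar>e \<bullet> h\<bar> \<le> norm e * norm h"
      by (rule Cauchy_Schwarz_ineq2)
    also have "\<dots> \<le> (c * norm h) * norm h"
      using d(1) d(2)[of x] x by (intro mult_right_mono) (auto simp: e_def h_def)
    finally have "- (c * (norm h)\<^sup>2) \<le> e \<bullet> h"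
      by (simp add: power2_eq_square)
    moreover have "gradient f x - gradient f a = hessian f a *v h + e"
      by (simp add: e_def)
    ultimately show "(x - a) \<bullet> (hessian f a *v (x - a)) - c * (norm (x - a))\<^sup>2
        \<le> (gradient f x - gradient f a) \<bullet> (x - a)"
      unfolding h_def[symmetric] by (simp add: inner_add_right inner_commute[of _ h])
  qed (use d in simp)
qed

section \<open>Optimality conditions of the two minimization steps\<close>

text \<open>The objective of the \<open>x\<close>-step is smooth, so its one-sided derivative along each segment
  into \<^term>\<open>C\<close> is nonnegative at a minimizer.\<close>

lemma x_step_optimality:
  fixes f :: "'a::euclidean_space \<Rightarrow> real" and A :: "'a \<Rightarrow> 'b::euclidean_space"
  assumes "linear A" "convex C" "f differentiable (at x)"
    and min: "is_arg_min (\<lambda>u. f u + l \<bullet> A u + \<beta> / 2 * (norm (A u - y))\<^sup>2) (\<lambda>u. u \<in> C) x"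
    and "z \<in> C"
  shows "0 \<le> gradient f x \<bullet> (z - x) + (l + \<beta> *\<^sub>R (A x - y)) \<bullet> A (z - x)"
proof (rule ccontr)
  define \<phi> where "\<phi> u = f u + l \<bullet> A u + \<beta> / 2 * (norm (A u - y))\<^sup>2" for u
  (* The objective along the segment, expanded so that its derivative at 0 can be read off. *)
  define \<psi> where "\<psi> t = f (x + t *\<^sub>R (z - x)) + (l \<bullet> A x + t * (l \<bullet> A (z - x))) +
      \<beta> / 2 * ((norm (A x - y))\<^sup>2 + 2 * t * ((A x - y) \<bullet> A (z - x)) +
        t\<^sup>2 * (norm (A (z - x)))\<^sup>2)" for t :: real
  define D where "D = gradient f x \<bullet> (z - x) + (l + \<beta> *\<^sub>R (A x - y)) \<bullet> A (z - x)"
  have \<phi>\<psi>: "\<phi> (x + t *\<^sub>R (z - x)) = \<psi> t" for t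
  proof -
    have Ax: "A (x + t *\<^sub>R (z - x)) = A x + t *\<^sub>R A (z - x)"
      by (simp only: linear_add[OF assms(1)] linear_scale[OF assms(1)])
    have "(norm (A x + t *\<^sub>R A (z - x) - y))\<^sup>2 = (norm ((A x - y) + t *\<^sub>R A (z - x)))\<^sup>2"
      by (simp add: algebra_simps)
    also have "\<dots> = (norm (A x - y))\<^sup>2 + 2 * t * ((A x - y) \<bullet> A (z - x)) +
        t\<^sup>2 * (norm (A (z - x)))\<^sup>2"
      by (simp only: power2_norm_eq_inner inner_add_left inner_add_right inner_scaleR_left
          inner_scaleR_right inner_commute[of "A (z - x)" "A x - y"])
        (simp add: power2_eq_square distrib_left)
    finally show ?thesis
      by (simp add: \<phi>_def \<psi>_def Ax inner_add_right)
  qed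
  have "(f has_derivative (\<lambda>h. h \<bullet> gradient f x)) (at x)"
    using gradient_works[OF assms(3)] by (simp add: gderiv_def)
  then have "((\<lambda>t. f (x + t *\<^sub>R (z - x))) has_derivative
      (\<lambda>t. (t *\<^sub>R (z - x)) \<bullet> gradient f x)) (at 0)"
    by (intro has_derivative_compose[where g = f and f = "\<lambda>t. x + t *\<^sub>R (z - x)"])
       (auto intro!: derivative_eq_intros)
  then have "((\<lambda>t. f (x + t *\<^sub>R (z - x))) has_real_derivative gradient f x \<bullet> (z - x)) (at 0)"
    by (simp add: has_field_derivative_def inner_commute mult_commute_abs)
  then have "(\<psi> has_real_derivative D) (at 0)"
    unfolding \<psi>_def D_def
    by (auto intro!: derivative_eq_intros simp: inner_add_left algebra_simps)
  moreover assume "\<not> 0 \<le> gradient f x \<bullet> (z - x) + (l + \<beta> *\<^sub>R (A x - y)) \<bullet> A (z - x)"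
  then have "D < 0"
    by (simp add: D_def)
  ultimately obtain d where d: "d > 0" "\<And>h. 0 < h \<Longrightarrow> h < d \<Longrightarrow> \<psi> h < \<psi> 0"
    using DERIV_neg_dec_right[of \<psi> D 0] by auto
  define t where "t = min 1 (d / 2)"
  have t: "0 < t" "t < d" "t \<le> 1"
    using d(1) by (auto simp: t_def)
  have "x \<in> C"
    using min by (simp add: is_arg_min_def)
  then have "x + t *\<^sub>R (z - x) \<in> C"
    using convexD_alt[OF assms(2), of x z t] t assms(5) by (simp add: algebra_simps)
  then have "\<not> \<phi> (x + t *\<^sub>R (z - x)) < \<phi> x"
    using min by (auto simp: is_arg_min_def \<phi>_def)
  then show False
    using \<phi>\<psi>[of t] \<phi>\<psi>[of 0] d(2)[OF t(1,2)] by simp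
qed

text \<open>Moving from \<^term>\<open>y\<close> towards \<^term>\<open>z\<close> by a fraction \<open>t\<close> changes \<^term>\<open>g\<close> by at most \<open>t\<close> times
  the difference of its values, by convexity, and the quadratic part by its derivative up to
  \<open>t\<^sup>2\<close>.  Dividing by \<open>t\<close> and letting \<open>t \<rightarrow> 0\<close> leaves the subgradient inequality.\<close>

lemma y_step_optimality:
  fixes g :: "'b::euclidean_space \<Rightarrow> ereal"
  assumes "polyhedral_convex g" "g y\<^sub>0 < \<infinity>"
    and min: "is_arg_min (\<lambda>v. g v + ereal (l \<bullet> (- v) + \<beta> / 2 * (norm (p - v))\<^sup>2)) (\<lambda>v. True) y"
  shows "l + \<beta> *\<^sub>R (p - y) \<in> subdifferential g y"
proof -
  define q where "q v = l \<bullet> (- v) + \<beta> / 2 * (norm (p - v))\<^sup>2" for v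
  define s where "s = l + \<beta> *\<^sub>R (p - y)"
  have le: "g y + ereal (q y) \<le> g v + ereal (q v)" for v
    using min by (auto simp: is_arg_min_def q_def not_less)
  have "g y \<noteq> -\<infinity>" for y
    using assms(1) by (simp add: polyhedral_convex_def)
  moreover have "g y \<noteq> \<infinity>"
    using le[of y\<^sub>0] assms(2) by auto
  ultimately obtain r where r: "g y = ereal r"
    by (cases "g y") auto
  have "s \<in> subdifferential g y"
  proof (rule subdifferentialI[where h = g and x = y, OF r])
    fix z
    define d where "d = z - y"
    show "ereal (r + s \<bullet> (z - y)) \<le> g z"
    proof (cases "g z")
      case (real a)
      have quad: "q (y + t *\<^sub>R d) = q y - t * (s \<bullet> d) + t\<^sup>2 * (\<beta> / 2 * (norm d)\<^sup>2)" for t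
      proof -
        have "(norm (e - t *\<^sub>R d))\<^sup>2 = (norm e)\<^sup>2 - 2 * t * (e \<bullet> d) + t\<^sup>2 * (norm d)\<^sup>2" for e
          unfolding power2_norm_eq_inner
          by (simp add: inner_diff_left inner_diff_right inner_commute power2_eq_square algebra_simps)
        from this[of "p - y"]
        have sq: "(norm (p - (y + t *\<^sub>R d)))\<^sup>2 =
            (norm (p - y))\<^sup>2 - 2 * t * ((p - y) \<bullet> d) + t\<^sup>2 * (norm d)\<^sup>2"
          by (simp add: diff_diff_eq)
        show ?thesis
          unfolding q_def sq by (simp add: s_def inner_add_left inner_add_right algebra_simps)
      qed
      have bound: "s \<bullet> d - t * (\<beta> / 2 * (norm d)\<^sup>2) \<le> a - r" if t: "0 < t" "t \<le> 1" for t
      proof -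
        have "g ((1 - t) *\<^sub>R y + t *\<^sub>R z) \<le> ereal ((1 - t) * r + t * a)"
          using polyhedral_convex_combination[OF assms(1), of y r z a t] r real t by simp
        then have gt: "g (y + t *\<^sub>R d) \<le> ereal ((1 - t) * r + t * a)"
          by (simp add: d_def algebra_simps)
        have "ereal (r + q y) \<le> g (y + t *\<^sub>R d) + ereal (q (y + t *\<^sub>R d))"
          using le[of "y + t *\<^sub>R d"] r by simp
        also have "\<dots> \<le> ereal ((1 - t) * r + t * a) + ereal (q (y + t *\<^sub>R d))"
          using gt by (rule add_right_mono)
        finally have "r + q y \<le> (1 - t) * r + t * a + q (y + t *\<^sub>R d)"
          by simp
        then have "t * (s \<bullet> d - t * (\<beta> / 2 * (norm d)\<^sup>2)) \<le> t * (a - r)"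
          unfolding quad by (simp add: algebra_simps power2_eq_square)
        then show ?thesis
          using t(1) by simp
      qed
      have "((\<lambda>t. s \<bullet> d - t * (\<beta> / 2 * (norm d)\<^sup>2)) \<longlongrightarrow> s \<bullet> d - 0 * (\<beta> / 2 * (norm d)\<^sup>2))
          (at_right 0)"
        by (intro tendsto_intros)
      moreover have "eventually (\<lambda>t. s \<bullet> d - t * (\<beta> / 2 * (norm d)\<^sup>2) \<le> a - r) (at_right 0)"
        unfolding eventually_at_right_field using bound by (intro exI[of _ 1]) simp
      ultimately have "s \<bullet> d \<le> a - r"
        using tendsto_upperbound[of _ "s \<bullet> d" "at_right (0::real)"] by simp
      then show ?thesis
        using real by (simp add: d_def)
    qed (use \<open>\<And>y. g y \<noteq> -\<infinity>\<close> in auto)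
  qed
  then show ?thesis
    by (simp add: s_def)
qed

section \<open>Descent along the ADMM iterates\<close>

lemma ADMM_subgradient:
  assumes "polyhedral_convex g" "g y\<^sub>0 < \<infinity>" "ADMM A C f g \<beta> x y lam"
  shows "lam (Suc k) \<in> subdifferential g (y (Suc k))"
proof -
  have "is_arg_min (\<lambda>v. g v + ereal (lam k \<bullet> (- v) + \<beta> / 2 * (norm (A (x (Suc k)) - v))\<^sup>2))
      (\<lambda>v. True) (y (Suc k))"
    and "lam (Suc k) = lam k + \<beta> *\<^sub>R (A (x (Suc k)) - y (Suc k))"
    using assms(3) by (simp_all add: ADMM_def)
  then show ?thesis
    using y_step_optimality[OF assms(1,2)] by simp
qed

lemma ADMM_stationarity:
  assumes "linear A" "convex C" "\<And>u. f differentiable (at u)" "ADMM A C f g \<beta> x y lam" "z \<in> C"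
  shows "0 \<le> gradient f (x (Suc k)) \<bullet> (z - x (Suc k)) +
    (lam (Suc k) + \<beta> *\<^sub>R (y (Suc k) - y k)) \<bullet> A (z - x (Suc k))"
proof -
  have "is_arg_min (\<lambda>u. f u + lam k \<bullet> A u + \<beta> / 2 * (norm (A u - y k))\<^sup>2)
      (\<lambda>u. u \<in> C) (x (Suc k))"
    and lam: "lam (Suc k) = lam k + \<beta> *\<^sub>R (A (x (Suc k)) - y (Suc k))"
    using assms(4) by (simp_all add: ADMM_def)
  from x_step_optimality[OF assms(1,2,3) this(1) assms(5)] show ?thesis
    by (simp add: lam algebra_simps)
qed

text \<open>The classical Lyapunov estimate for ADMM, with the monotonicity term of \<^term>\<open>gradient f\<close> kept on
  the left instead of being discarded as nonnegative.  It adds the two variational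
  inequalities on \<^term>\<open>C\<close>, at the iterate and at the reference point, and uses monotonicity of the
  subdifferential of \<^term>\<open>g\<close> twice: between the iterate and the reference point, and between
  consecutive iterates.  The latter is where the initial condition on the multiplier matters.\<close>

lemma ADMM_descent:
  fixes A :: "real ^ 'n \<Rightarrow> real ^ 'm"
  assumes "linear A" "convex C" "\<And>u. f differentiable (at u)" "polyhedral_convex g" "\<beta> > 0"
    and admm: "ADMM A C f g \<beta> x y lam"
    and subgr: "lam k \<in> subdifferential g (y k)"
    and stat: "0 \<in> (gradient f a + adjoint A s) +o subdifferential (indicator_fun C) a"
    and s: "s \<in> subdifferential g (A a)"
  shows "\<beta>\<^sup>2 * (norm (y (Suc k) - A a))\<^sup>2 + (norm (lam (Suc k) - s))\<^sup>2 +
      (norm (lam (Suc k) - lam k))\<^sup>2 +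
      2 * \<beta> * ((gradient f (x (Suc k)) - gradient f a) \<bullet> (x (Suc k) - a))
    \<le> \<beta>\<^sup>2 * (norm (y k - A a))\<^sup>2 + (norm (lam k - s))\<^sup>2"
proof -
  define p q where "p = \<beta> *\<^sub>R (y (Suc k) - A a)" and "q = \<beta> *\<^sub>R (y k - A a)"
  define m n where "m = lam (Suc k) - s" and "n = lam k - s"
  define G where "G = (gradient f (x (Suc k)) - gradient f a) \<bullet> (x (Suc k) - a)"
  define h where "h = x (Suc k) - a"
  have gA: "g (A a) < \<infinity>"
    using s by (auto simp: subdifferential_def)
  have xC: "x (Suc k) \<in> C"
    using admm by (simp add: ADMM_def is_arg_min_def)
  have aC: "a \<in> C" and stat': "0 \<le> gradient f a \<bullet> h + s \<bullet> A h"
    using stat xC by (auto simp: stationary_iff[OF assms(1)] h_def)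
  have subgr': "lam (Suc k) \<in> subdifferential g (y (Suc k))"
    by (rule ADMM_subgradient[OF assms(4) gA admm])
  have "0 \<le> m \<bullet> (y (Suc k) - A a)" "0 \<le> (lam (Suc k) - lam k) \<bullet> (y (Suc k) - y k)"
    using subdifferential_monotone subgr subgr' s by (auto simp: m_def)
  moreover have "m \<bullet> p = \<beta> * (m \<bullet> (y (Suc k) - A a))"
    "(m - n) \<bullet> (p - q) = \<beta> * ((lam (Suc k) - lam k) \<bullet> (y (Suc k) - y k))"
    by (simp_all add: p_def q_def m_def n_def scaleR_diff_right[symmetric])
  ultimately have mono: "0 \<le> m \<bullet> p" "0 \<le> (m - n) \<bullet> (p - q)"
    using \<open>\<beta> > 0\<close> by simp_all
  have "lam (Suc k) + \<beta> *\<^sub>R (y (Suc k) - y k) = s + (m + (p - q))"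
    by (simp add: m_def p_def q_def algebra_simps)
  moreover have "a - x (Suc k) = - h"
    by (simp add: h_def)
  ultimately have "0 \<le> gradient f (x (Suc k)) \<bullet> (- h) + (s + (m + (p - q))) \<bullet> A (- h)"
    using ADMM_stationarity[OF assms(1-3) admm aC, of k] by simp
  then have "G + (m + (p - q)) \<bullet> A h \<le> 0"
    using stat' by (simp add: G_def h_def[symmetric] linear_neg[OF assms(1)] inner_diff_left
        inner_add_left)
  moreover have "\<beta> *\<^sub>R A h = p + (m - n)"
    using admm by (simp add: ADMM_def p_def m_def n_def h_def linear_diff[OF assms(1)] algebra_simps)
  then have "\<beta> * ((m + (p - q)) \<bullet> A h) = (m + (p - q)) \<bullet> (p + (m - n))"
    by (metis inner_scaleR_right)
  ultimately have "\<beta> * G + (m + (p - q)) \<bullet> (p + (m - n)) \<le> 0"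
    using \<open>\<beta> > 0\<close> by (smt (verit) distrib_left mult_le_0_iff)
  (* The polarization identity turns the mixed products into differences of squares. *)
  moreover have "2 * ((m + (p - q)) \<bullet> (p + (m - n))) =
      2 * (m \<bullet> p) + 2 * ((m - n) \<bullet> (p - q)) + (m \<bullet> m + (m - n) \<bullet> (m - n) - n \<bullet> n) +
      (p \<bullet> p + (p - q) \<bullet> (p - q) - q \<bullet> q)"
    by (simp add: inner_add_left inner_add_right inner_diff_left inner_diff_right
        inner_commute algebra_simps)
  moreover have "0 \<le> (p - q) \<bullet> (p - q)"
    by simp
  ultimately have "p \<bullet> p + m \<bullet> m + (m - n) \<bullet> (m - n) + 2 * (\<beta> * G) \<le> q \<bullet> q + n \<bullet> n"
    using mono by linarith
  moreover have "m - n = lam (Suc k) - lam k"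
    by (simp add: m_def n_def)
  moreover have "p \<bullet> p = \<beta>\<^sup>2 * (norm (y (Suc k) - A a))\<^sup>2" "q \<bullet> q = \<beta>\<^sup>2 * (norm (y k - A a))\<^sup>2"
    unfolding dot_square_norm by (simp_all add: p_def q_def power_mult_distrib)
  ultimately show ?thesis
    by (simp add: m_def n_def G_def power2_norm_eq_inner mult.assoc)
qed

text \<open>A bound on the new multiplier before anything is known about descent.  The multiplier update is
  \<open>\<beta>\<close> times the residual of a proximal map, hence nonexpansive.\<close>

lemma ADMM_multiplier_bound:
  assumes "linear A" "polyhedral_convex g" "\<beta> > 0" "ADMM A C f g \<beta> x y lam"
    and s: "s \<in> subdifferential g (A a)"
  shows "norm (lam (Suc k) - s) \<le> norm (lam k - s) + \<beta> * norm (A (x (Suc k) - a))"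
proof -
  define m where "m = lam (Suc k) - s"
  define e where "e = (lam k - s) + \<beta> *\<^sub>R A (x (Suc k) - a)"
  have gA: "g (A a) < \<infinity>"
    using s by (auto simp: subdifferential_def)
  have "0 \<le> m \<bullet> (y (Suc k) - A a)"
    unfolding m_def
    by (intro subdifferential_monotone[where h = g] ADMM_subgradient[OF assms(2) gA assms(4)] s)
  then have "0 \<le> m \<bullet> (\<beta> *\<^sub>R (y (Suc k) - A a))"
    using assms(3) by simp
  also have "\<beta> *\<^sub>R (y (Suc k) - A a) = e - m"
    using assms(4) by (simp add: ADMM_def e_def m_def linear_diff[OF assms(1)] algebra_simps)
  finally have "norm m * norm m \<le> m \<bullet> e"
    by (simp add: inner_diff_right dot_square_norm power2_eq_square)
  also have "\<dots> \<le> norm m * norm e"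
    by (rule norm_cauchy_schwarz)
  finally have "norm m \<le> norm e"
    by (cases "m = 0") simp_all
  also have "\<dots> \<le> norm (lam k - s) + \<beta> * norm (A (x (Suc k) - a))"
    unfolding e_def using norm_triangle_ineq[of "lam k - s" "\<beta> *\<^sub>R A (x (Suc k) - a)"] assms(3) by simp
  finally show ?thesis
    by (simp add: m_def)
qed

section \<open>Convergence of the iterates\<close>

lemma descent_gap_tendsto_zero:
  fixes \<Phi> D :: "nat \<Rightarrow> real"
  assumes "\<And>k. 0 \<le> \<Phi> k" "\<And>k. 0 \<le> D k" "\<And>k. \<Phi> (Suc k) + D k \<le> \<Phi> k"
  shows "D \<longlonglongrightarrow> 0"
proof -
  have "decseq \<Phi>"
    unfolding decseq_Suc_iff using assms(2,3) by (smt (verit))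
  then obtain l where l: "\<Phi> \<longlonglongrightarrow> l"
    using decseq_convergent[of \<Phi> 0] assms(1) by blast
  have gap: "(\<lambda>k. \<Phi> k - \<Phi> (Suc k)) \<longlonglongrightarrow> 0"
    using tendsto_diff[OF l LIMSEQ_Suc[OF l]] by simp
  show ?thesis
  proof (rule tendsto_sandwich[OF _ _ tendsto_const gap])
    show "\<forall>\<^sub>F k in sequentially. D k \<le> \<Phi> k - \<Phi> (Suc k)"
      using assms(3) by (intro always_eventually allI) (smt (verit))
  qed (use assms(2) in simp)
qed

lemma tendsto_of_squared_norm_bound:
  fixes u :: "nat \<Rightarrow> 'a::real_normed_vector"
  assumes "D \<longlonglongrightarrow> (0::real)" "c > 0" "\<And>k. c * (norm (u k - l))\<^sup>2 \<le> D k"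
  shows "u \<longlonglongrightarrow> l"
proof -
  have "norm (u k - l) \<le> sqrt (D k / c)" for k
    using assms(2) assms(3)[of k] by (intro real_le_rsqrt) (simp add: field_simps)
  moreover have "(\<lambda>k. sqrt (D k / c)) \<longlonglongrightarrow> sqrt (0 / c)"
    by (intro tendsto_intros assms(1)) (use assms(2) in simp)
  ultimately have "(\<lambda>k. u k - l) \<longlonglongrightarrow> 0"
    using Lim_null_comparison[of "\<lambda>k. u k - l" "\<lambda>k. sqrt (D k / c)" sequentially] by simp
  then show ?thesis
    by (simp add: LIM_zero_iff)
qed

text \<open>The assumption \<open>growth\<close> replaces convexity of \<^term>\<open>f\<close>.  Its defect
  \<open>b * (norm (A u - v))\<^sup>2\<close> is at an iterate equal to \<open>b / \<beta>\<^sup>2\<close> times the squared multiplier step, and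
  \<open>2 * b < \<beta>\<close> makes the multiplier term of the descent estimate absorb it.  Whether \<open>growth\<close>
  applies depends on the multiplier being close to \<^term>\<open>s\<close>, which an induction along the iteration
  preserves because the merit function decreases.

  Once the primal iterates converge, every limit point of the multipliers is again a
  multiplier at \<^term>\<open>a\<close>.  The merit function centred at such a limit point is
  decreasing as well, and it tends to zero along a subsequence, so the multipliers
  converge.\<close>

lemma ADMM_convergence:
  fixes A :: "real ^ 'n \<Rightarrow> real ^ 'm"
  assumes "linear A" "convex C" "continuously_differentiable f" "polyhedral_convex g"
    and \<beta>: "0 < b" "2 * b < \<beta>" and "c > 0"
    and stat: "0 \<in> (gradient f a + adjoint A s) +o subdifferential (indicator_fun C) a"
    and s: "s \<in> subdifferential g (A a)"
    and perturb: "\<And>t v. norm (t - s) \<le> 2 * \<rho> \<Longrightarrow> t \<in> subdifferential g v \<Longrightarrow>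
      s \<in> subdifferential g v"
    and growth: "\<And>u v. u \<in> C \<Longrightarrow> u \<in> X \<Longrightarrow> s \<in> subdifferential g v \<Longrightarrow>
      c * (norm (u - a))\<^sup>2 - b * (norm (A u - v))\<^sup>2 \<le> (gradient f u - gradient f a) \<bullet> (u - a)"
    and X: "\<And>u. u \<in> X \<Longrightarrow> \<beta> * norm (A (u - a)) \<le> \<rho>"
    and admm: "ADMM A C f g \<beta> x y lam" and lam0: "lam 0 \<in> subdifferential g (y 0)"
    and start: "\<beta>\<^sup>2 * (norm (y 0 - A a))\<^sup>2 + (norm (lam 0 - s))\<^sup>2 \<le> \<rho>\<^sup>2" "0 \<le> \<rho>"
    and xX: "\<And>k. x (Suc k) \<in> X"
  obtains l where "x \<longlonglongrightarrow> a" "y \<longlonglongrightarrow> A a" "lam \<longlonglongrightarrow> l" "l \<in> cball s \<rho>"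
    "0 \<in> (gradient f a + adjoint A l) +o subdifferential (indicator_fun C) a"
    "l \<in> subdifferential g (A a)"
proof -
  have diff: "f differentiable (at u)" for u
    using assms(3) by (simp add: continuously_differentiable_def)
  have "\<beta> > 0"
    using \<beta> by simp
  define \<kappa> where "\<kappa> = 1 - 2 * b / \<beta>"
  have \<kappa>: "\<kappa> > 0"
    using \<beta> by (simp add: \<kappa>_def)
  define \<Phi> where "\<Phi> t k = \<beta>\<^sup>2 * (norm (y k - A a))\<^sup>2 + (norm (lam k - t))\<^sup>2" for t k
  define D where "D k = 2 * \<beta> * c * (norm (x (Suc k) - a))\<^sup>2 + \<kappa> * (norm (lam (Suc k) - lam k))\<^sup>2" for k
  have D_nonneg: "0 \<le> D k" for k
    using \<open>\<beta> > 0\<close> \<open>c > 0\<close> \<kappa> by (simp add: D_def)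
  have gA: "g (A a) < \<infinity>"
    using s by (auto simp: subdifferential_def)
  have subgr: "lam k \<in> subdifferential g (y k)" for k
    using ADMM_subgradient[OF assms(4) gA admm] lam0 by (cases k) simp_all
  have xC: "x (Suc k) \<in> C" for k
    using admm by (simp add: ADMM_def is_arg_min_def)
  have res: "A (x (Suc k)) - y (Suc k) = (1 / \<beta>) *\<^sub>R (lam (Suc k) - lam k)" for k
    using admm \<open>\<beta> > 0\<close> by (simp add: ADMM_def)
  have descent_step: "\<Phi> t (Suc k) + D k \<le> \<Phi> t k"
    if "0 \<in> (gradient f a + adjoint A t) +o subdifferential (indicator_fun C) a"
      "t \<in> subdifferential g (A a)" "s \<in> subdifferential g (y (Suc k))" for t k
  proof -
    define G where "G = (gradient f (x (Suc k)) - gradient f a) \<bullet> (x (Suc k) - a)"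
    have "c * (norm (x (Suc k) - a))\<^sup>2 - b * (norm (A (x (Suc k)) - y (Suc k)))\<^sup>2 \<le> G"
      unfolding G_def by (rule growth[OF xC xX that(3)])
    then have "2 * \<beta> * (c * (norm (x (Suc k) - a))\<^sup>2 - b * (norm (A (x (Suc k)) - y (Suc k)))\<^sup>2)
        \<le> 2 * \<beta> * G"
      using \<open>\<beta> > 0\<close> by (intro mult_left_mono) simp_all
    moreover have "2 * \<beta> * (b * (norm (A (x (Suc k)) - y (Suc k)))\<^sup>2) =
        2 * b / \<beta> * (norm (lam (Suc k) - lam k))\<^sup>2"
      unfolding res using \<open>\<beta> > 0\<close> by (simp add: power_divide power2_eq_square)
    ultimately have "D k \<le> (norm (lam (Suc k) - lam k))\<^sup>2 + 2 * \<beta> * G"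
      by (simp add: D_def \<kappa>_def right_diff_distrib left_diff_distrib)
    then show ?thesis
      using ADMM_descent[OF assms(1,2) diff assms(4) \<open>\<beta> > 0\<close> admm subgr[of k] that(1,2)]
      by (simp add: \<Phi>_def G_def)
  qed
  have bound: "norm (lam k - s) \<le> \<rho>" if "\<Phi> s k \<le> \<rho>\<^sup>2" for k
  proof -
    have "0 \<le> \<beta>\<^sup>2 * (norm (y k - A a))\<^sup>2"
      by simp
    then have "(norm (lam k - s))\<^sup>2 \<le> \<rho>\<^sup>2"
      using that unfolding \<Phi>_def by linarith
    then show ?thesis
      using start(2) by (simp add: power2_le_iff_abs_le)
  qed
  have near_step: "s \<in> subdifferential g (y (Suc k))" if "\<Phi> s k \<le> \<rho>\<^sup>2" for k
  proof (rule perturb[OF _ subgr])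
    show "norm (lam (Suc k) - s) \<le> 2 * \<rho>"
      using ADMM_multiplier_bound[OF assms(1,4) \<open>\<beta> > 0\<close> admm s, of k] bound[OF that] X[OF xX[of k]]
      by linarith
  qed
  have \<Phi>_bound: "\<Phi> s k \<le> \<rho>\<^sup>2" for k
  proof (induction k)
    case 0
    then show ?case
      using start by (simp add: \<Phi>_def)
  next
    case (Suc k)
    then show ?case
      using descent_step[OF stat s near_step[OF Suc]] D_nonneg[of k] by linarith
  qed
  have s_y: "s \<in> subdifferential g (y (Suc k))" for k
    by (rule near_step[OF \<Phi>_bound])
  have "D \<longlonglongrightarrow> 0"
    by (rule descent_gap_tendsto_zero[of "\<Phi> s"])
      (simp_all add: D_nonneg descent_step[OF stat s s_y], simp add: \<Phi>_def)
  have x_lim': "(\<lambda>k. x (Suc k)) \<longlonglongrightarrow> a"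
    using \<open>\<beta> > 0\<close> \<open>c > 0\<close> \<kappa>
    by (intro tendsto_of_squared_norm_bound[OF \<open>D \<longlonglongrightarrow> 0\<close>, of "2 * \<beta> * c"]) (simp_all add: D_def)
  have "(\<lambda>k. lam (Suc k) - lam k) \<longlonglongrightarrow> 0"
    using \<open>\<beta> > 0\<close> \<open>c > 0\<close> \<kappa>
    by (intro tendsto_of_squared_norm_bound[OF \<open>D \<longlonglongrightarrow> 0\<close>, of \<kappa>]) (simp_all add: D_def)
  have A_lim: "(\<lambda>k. A (u k)) \<longlonglongrightarrow> A v" if "u \<longlonglongrightarrow> v" for u v
    using linear_continuous_at[of A v] assms(1) that
    by (simp add: linear_linear isCont_tendsto_compose)
  have y_eq: "y (Suc k) = A (x (Suc k)) - (1 / \<beta>) *\<^sub>R (lam (Suc k) - lam k)" for k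
    using res[of k] by (simp add: algebra_simps)
  have "(\<lambda>k. y (Suc k)) \<longlonglongrightarrow> A a - (1 / \<beta>) *\<^sub>R 0"
    unfolding y_eq
    by (intro tendsto_intros A_lim x_lim' \<open>(\<lambda>k. lam (Suc k) - lam k) \<longlonglongrightarrow> 0\<close>)
  then have y_lim: "y \<longlonglongrightarrow> A a"
    using LIMSEQ_imp_Suc[of y] by simp
  have x_lim: "x \<longlonglongrightarrow> a"
    by (rule LIMSEQ_imp_Suc[OF x_lim'])
  have "\<forall>k. lam (Suc k) \<in> cball s \<rho>"
    using bound[OF \<Phi>_bound] by (simp add: dist_norm norm_minus_commute)
  then obtain l r where l: "l \<in> cball s \<rho>" and r: "strict_mono r"
    and lam_lim: "((\<lambda>k. lam (Suc k)) \<circ> r) \<longlonglongrightarrow> l"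
    using compact_cball[of s \<rho>] unfolding compact_def by metis
  have sub: "(\<lambda>k. u (r k)) \<longlonglongrightarrow> v" if "u \<longlonglongrightarrow> v" for u :: "nat \<Rightarrow> 'z::topological_space" and v
    using LIMSEQ_subseq_LIMSEQ[OF that r] by (simp add: o_def)
  have lam_lim: "(\<lambda>k. lam (Suc (r k))) \<longlonglongrightarrow> l"
    using lam_lim by (simp add: o_def)
  have grad_lim: "(\<lambda>k. gradient f (x (Suc (r k)))) \<longlonglongrightarrow> gradient f a"
    using assms(3) sub[OF x_lim'] continuous_on_tendsto_compose[of UNIV "gradient f"]
    by (auto simp: continuously_differentiable_def)
  have aC: "a \<in> C"
    using stat by (simp add: stationary_iff[OF assms(1)])
  have l_stat: "0 \<in> (gradient f a + adjoint A l) +o subdifferential (indicator_fun C) a"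
    unfolding stationary_iff[OF assms(1)]
  proof (intro conjI ballI aC)
    fix z
    assume z: "z \<in> C"
    have "(\<lambda>k. gradient f (x (Suc (r k))) \<bullet> (z - x (Suc (r k))) +
        (lam (Suc (r k)) + \<beta> *\<^sub>R (y (Suc (r k)) - y (r k))) \<bullet> A (z - x (Suc (r k)))) \<longlonglongrightarrow>
        gradient f a \<bullet> (z - a) + (l + \<beta> *\<^sub>R (A a - A a)) \<bullet> A (z - a)"
      by (intro tendsto_intros A_lim grad_lim lam_lim sub[OF x_lim'] sub[OF LIMSEQ_Suc[OF y_lim]]
          sub[OF y_lim])
    from LIMSEQ_le_const[OF this, of 0] show "0 \<le> gradient f a \<bullet> (z - a) + l \<bullet> A (z - a)"
      using ADMM_stationarity[OF assms(1,2) diff admm z] by simp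
  qed
  (* The values of g at the iterates are known through the common subgradient s, so the
     subgradient inequalities of the multipliers pass to the limit. *)
  obtain w where w: "g (A a) = ereal w"
    using s by (rule subdifferentialE) blast
  have l_sub: "l \<in> subdifferential g (A a)"
  proof (rule subdifferentialI[where h = g and x = "A a", OF w])
    fix z
    have "(\<lambda>k. w + s \<bullet> (y (Suc (r k)) - A a) + lam (Suc (r k)) \<bullet> (z - y (Suc (r k)))) \<longlonglongrightarrow>
        w + s \<bullet> (A a - A a) + l \<bullet> (z - A a)"
      by (intro tendsto_intros lam_lim sub[OF LIMSEQ_Suc[OF y_lim]])
    then have lim: "(\<lambda>k. ereal (w + s \<bullet> (y (Suc (r k)) - A a) + lam (Suc (r k)) \<bullet> (z - y (Suc (r k)))))
        \<longlonglongrightarrow> ereal (w + l \<bullet> (z - A a))"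
      by simp
    have "ereal (w + s \<bullet> (y (Suc k) - A a) + lam (Suc k) \<bullet> (z - y (Suc k))) \<le> g z" for k
    proof -
      have "g (y (Suc k)) = ereal (w + s \<bullet> (y (Suc k) - A a))"
        by (rule common_subgradient_value[OF s s_y w])
      then show ?thesis
        using subgr[of "Suc k"] by (auto simp: subdifferential_def)
    qed
    then show "ereal (w + l \<bullet> (z - A a)) \<le> g z"
      using LIMSEQ_le_const2[OF lim, of "g z"] by blast
  qed
  have "decseq (\<Phi> l)"
    unfolding decseq_Suc_iff
  proof
    fix k
    show "\<Phi> l (Suc k) \<le> \<Phi> l k"
      using descent_step[OF l_stat l_sub s_y, of k] D_nonneg[of k] by linarith
  qed
  moreover have "0 \<le> \<Phi> l k" for k
    by (simp add: \<Phi>_def)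
  ultimately obtain v where v: "\<Phi> l \<longlonglongrightarrow> v"
    using decseq_convergent[of "\<Phi> l" 0] by blast
  have "(\<lambda>k. \<Phi> l (Suc (r k))) \<longlonglongrightarrow> \<beta>\<^sup>2 * (norm (A a - A a))\<^sup>2 + (norm (l - l))\<^sup>2"
    unfolding \<Phi>_def by (intro tendsto_intros lam_lim sub[OF LIMSEQ_Suc[OF y_lim]])
  moreover have "(\<lambda>k. \<Phi> l (Suc (r k))) \<longlonglongrightarrow> v"
    by (rule sub[OF LIMSEQ_Suc[OF v]])
  ultimately have "v = 0"
    using LIMSEQ_unique by fastforce
  have "lam \<longlonglongrightarrow> l"
    using v unfolding \<open>v = 0\<close> by (rule tendsto_of_squared_norm_bound[where c = 1]) (simp_all add: \<Phi>_def)
  then show thesis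
    using that x_lim y_lim l l_stat l_sub by blast
qed

theorem proposition9:
  fixes A :: "real ^ 'n \<Rightarrow> real ^ 'm"
    and C :: "(real ^ 'n) set"
    and f :: "real ^ 'n \<Rightarrow> real"
    and g :: "real ^ 'm \<Rightarrow> ereal"
    and xbar :: "real ^ 'n"
    and lambar :: "real ^ 'm"
  assumes "linear A"
    and "C \<noteq> {}" and "closed C" and "convex C"
    and "continuously_differentiable f"
    and "polyhedral_convex g"
    and "edom g \<inter> A ` rel_interior C \<noteq> {}"
    and "0 \<in> (gradient f xbar + adjoint A lambar) +o subdifferential (indicator_fun C) xbar"
    and "lambar \<in> subdifferential g (A xbar)"
    and "\<exists>U. convex U \<and> xbar \<in> interior U \<and> hessian_continuous_on U f"
    and "pos_def_relative (hessian f xbar) (parallel_subspace C \<inter> SA_space A g xbar lambar)"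
  shows "\<exists>\<beta>\<^sub>0>0. \<forall>\<beta>>2 * \<beta>\<^sub>0. \<exists>X L \<rho>.
    closed X \<and> convex X \<and> xbar \<in> interior X \<and>
    closed L \<and> convex L \<and> lambar \<in> interior L \<and>
    \<rho> > 0 \<and> cball lambar \<rho> \<subseteq> interior L \<and>
    (\<forall>x y lam.
      ADMM A C f g \<beta> x y lam \<longrightarrow>
      lam 0 \<in> subdifferential g (y 0) \<longrightarrow>
      \<beta>\<^sup>2 * (norm (y 0 - A xbar))\<^sup>2 + (norm (lam 0 - lambar))\<^sup>2 \<le> \<rho>\<^sup>2 \<longrightarrow>
      (\<forall>k\<ge>1. x k \<in> X) \<longrightarrow>
      x \<longlonglongrightarrow> xbar \<and> y \<longlonglongrightarrow> A xbar \<and>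
      (\<exists>lamhat \<in> multiplier_set A C f g xbar L.
        lam \<longlonglongrightarrow> lamhat \<and> lamhat \<in> cball lambar \<rho>))"
proof -
  have diff: "f differentiable (at u)" for u
    using assms(5) by (simp add: continuously_differentiable_def)
  have xC: "xbar \<in> C"
    using assms(8) by (simp add: stationary_iff[OF assms(1)])
  define W where "W = span {v - A xbar | v. lambar \<in> subdifferential g v}"
  have "W \<subseteq> S_space g (A xbar) lambar"
    unfolding W_def by (rule span_common_subgradient_subset_S_space[OF assms(6,9)])
  then have pd: "pos_def_relative (hessian f xbar) (parallel_subspace C \<inter> {v. A v \<in> W})"
    using assms(11) by (auto simp: pos_def_relative_def SA_space_def)
  obtain b c where b: "b > 0" and c: "c > 0" and
    penalty: "\<And>v w. v \<in> parallel_subspace C \<Longrightarrow> w \<in> W \<Longrightarrow>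
      c * (norm v)\<^sup>2 \<le> v \<bullet> (hessian f xbar *v v) + b * (norm (A v - w))\<^sup>2"
    by (rule pos_def_relative_penalty[OF assms(1) subspace_parallel_subspace[OF xC]
          subspace_span[of "{v - A xbar | v. lambar \<in> subdifferential g v}", folded W_def] pd])
      (rule that)
  have "gradient f differentiable (at xbar)"
    using assms(10) interior_subset by (auto simp: hessian_continuous_on_def)
  from this c obtain r\<^sub>0 where r\<^sub>0: "r\<^sub>0 > 0" and
    quad: "\<And>u. norm (u - xbar) \<le> r\<^sub>0 \<Longrightarrow>
      (u - xbar) \<bullet> (hessian f xbar *v (u - xbar)) - c / 2 * (norm (u - xbar))\<^sup>2
      \<le> (gradient f u - gradient f xbar) \<bullet> (u - xbar)"
    by (rule gradient_quadratic_lower_bound[where c = "c / 2", OF _ half_gt_zero]) (rule that)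
  obtain \<delta> where \<delta>: "\<delta> > 0" and perturb: "\<And>t v. norm (t - lambar) \<le> \<delta> \<Longrightarrow>
      t \<in> subdifferential g v \<Longrightarrow> lambar \<in> subdifferential g v"
    by (rule subgradient_perturbation[OF assms(6), where s = lambar]) (rule that)
  obtain K where K: "K > 0" "\<And>v. norm (A v) \<le> K * norm v"
    using linear_bounded_pos[OF assms(1)] by blast
  (* Half of the curvature constant is given up to the remainder of the gradient. *)
  have growth: "c / 2 * (norm (u - xbar))\<^sup>2 - b * (norm (A u - v))\<^sup>2
      \<le> (gradient f u - gradient f xbar) \<bullet> (u - xbar)"
    if "u \<in> C" "norm (u - xbar) \<le> r\<^sub>0" "lambar \<in> subdifferential g v" for u v
  proof -
    have "v - A xbar \<in> W"
      using that(3) by (auto simp: W_def intro: span_base)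
    moreover have "A (u - xbar) - (v - A xbar) = A u - v"
      by (simp add: linear_diff[OF assms(1)])
    ultimately have "c * (norm (u - xbar))\<^sup>2 \<le>
        (u - xbar) \<bullet> (hessian f xbar *v (u - xbar)) + b * (norm (A u - v))\<^sup>2"
      using penalty[OF diff_mem_parallel_subspace[OF that(1) xC]] by metis
    then show ?thesis
      using quad[OF that(2)] by (simp add: field_simps)
  qed
  show ?thesis
  proof (intro exI[of _ b] conjI allI impI b)
    fix \<beta> :: real
    assume \<beta>: "2 * b < \<beta>"
    then have "\<beta> > 0"
      using b by simp
    (* One half of the radius for the perturbation result is left to the current multiplier,
       the other half to the contribution of the next primal iterate, which scales with the
       penalty parameter. *)
    define \<rho> r where "\<rho> = \<delta> / 2" and "r = min r\<^sub>0 (\<rho> / (\<beta> * K))"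
    have \<rho>: "\<rho> > 0" "2 * \<rho> = \<delta>" and r: "r > 0"
      using \<delta> r\<^sub>0 \<open>\<beta> > 0\<close> K(1) by (simp_all add: \<rho>_def r_def)
    have X: "\<beta> * norm (A (u - xbar)) \<le> \<rho>" "norm (u - xbar) \<le> r\<^sub>0" if "u \<in> cball xbar r" for u
    proof -
      have u: "norm (u - xbar) \<le> r"
        using that by (simp add: dist_norm norm_minus_commute)
      then show "norm (u - xbar) \<le> r\<^sub>0"
        by (simp add: r_def)
      have "\<beta> * norm (A (u - xbar)) \<le> \<beta> * (K * norm (u - xbar))"
        using K(2) \<open>\<beta> > 0\<close> by simp
      also have "\<dots> \<le> \<beta> * (K * (\<rho> / (\<beta> * K)))"
        using u K(1) \<open>\<beta> > 0\<close> by (intro mult_left_mono) (simp_all add: r_def)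
      also have "\<dots> = \<rho>"
        using K(1) \<open>\<beta> > 0\<close> by simp
      finally show "\<beta> * norm (A (u - xbar)) \<le> \<rho>" .
    qed
    have conv: "x \<longlonglongrightarrow> xbar \<and> y \<longlonglongrightarrow> A xbar \<and>
        (\<exists>lamhat \<in> multiplier_set A C f g xbar (cball lambar \<delta>).
          lam \<longlonglongrightarrow> lamhat \<and> lamhat \<in> cball lambar \<rho>)"
      if admm: "ADMM A C f g \<beta> x y lam" and lam0: "lam 0 \<in> subdifferential g (y 0)"
        and start: "\<beta>\<^sup>2 * (norm (y 0 - A xbar))\<^sup>2 + (norm (lam 0 - lambar))\<^sup>2 \<le> \<rho>\<^sup>2"
        and xX: "\<forall>k\<ge>1. x k \<in> cball xbar r" for x y lam
    proof -
      obtain l where l: "x \<longlonglongrightarrow> xbar" "y \<longlonglongrightarrow> A xbar" "lam \<longlonglongrightarrow> l" "l \<in> cball lambar \<rho>"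
        "0 \<in> (gradient f xbar + adjoint A l) +o subdifferential (indicator_fun C) xbar"
        "l \<in> subdifferential g (A xbar)"
      proof (rule ADMM_convergence[OF assms(1,4,5,6) b \<beta> _ assms(8,9) _ _ _ admm lam0 start])
        show "c / 2 > 0" "0 \<le> \<rho>"
          using c \<rho> by simp_all
        show "x (Suc k) \<in> cball xbar r" for k
          using xX by simp
        show "lambar \<in> subdifferential g v"
          if "norm (t - lambar) \<le> 2 * \<rho>" "t \<in> subdifferential g v" for t v
          using perturb that \<rho>(2) by simp
        show "\<beta> * norm (A (u - xbar)) \<le> \<rho>" if "u \<in> cball xbar r" for u
          by (rule X(1)[OF that])
        show "c / 2 * (norm (u - xbar))\<^sup>2 - b * (norm (A u - v))\<^sup>2
            \<le> (gradient f u - gradient f xbar) \<bullet> (u - xbar)"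
          if "u \<in> C" "u \<in> cball xbar r" "lambar \<in> subdifferential g v" for u v
          by (rule growth[OF that(1) X(2)[OF that(2)] that(3)])
      qed (rule that)
      have "l \<in> cball lambar \<delta>"
        using l(4) \<rho> by simp
      then have "l \<in> multiplier_set A C f g xbar (cball lambar \<delta>)"
        using l(5,6) by (simp add: multiplier_set_def normal_cone_def)
      then show ?thesis
        using l(1-4) by blast
    qed
    have sub: "cball lambar \<rho> \<subseteq> interior (cball lambar \<delta>)"
      using \<rho> \<delta> by (auto simp: dist_norm)
    then show "\<exists>X L \<rho>. closed X \<and> convex X \<and> xbar \<in> interior X \<and>
        closed L \<and> convex L \<and> lambar \<in> interior L \<and> \<rho> > 0 \<and> cball lambar \<rho> \<subseteq> interior L \<and>
        (\<forall>x y lam. ADMM A C f g \<beta> x y lam \<longrightarrow> lam 0 \<in> subdifferential g (y 0) \<longrightarrow>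
          \<beta>\<^sup>2 * (norm (y 0 - A xbar))\<^sup>2 + (norm (lam 0 - lambar))\<^sup>2 \<le> \<rho>\<^sup>2 \<longrightarrow>
          (\<forall>k\<ge>1. x k \<in> X) \<longrightarrow>
          x \<longlonglongrightarrow> xbar \<and> y \<longlonglongrightarrow> A xbar \<and>
          (\<exists>lamhat \<in> multiplier_set A C f g xbar L. lam \<longlonglongrightarrow> lamhat \<and> lamhat \<in> cball lambar \<rho>))"
    proof (intro exI[of _ "cball xbar r"] exI[of _ "cball lambar \<delta>"] exI[of _ \<rho>] conjI)
      show "xbar \<in> interior (cball xbar r)" "lambar \<in> interior (cball lambar \<delta>)"
        using r \<delta> by simp_all
    qed (use sub \<rho>(1) conv in \<open>simp_all only: closed_cball convex_cball, blast?\<close>)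
  qed
qed

end
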